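(* (Weak law of large numbers.) Let $\{X_t\}_{t\ge 0}$ be a semi-Lévy process on $\mathbb{R}^d$ with period $p>0$ and let $c\in\mathbb{R}^d$. Then the following are equivalent. (i) $t^{-1}X_t\to c$ in probability as $t\to\infty$. (ii) $\lim_{t\to\infty}tP(|X_p|>t)=0$ and $\lim_{t\to\infty}E[X_p\,\mathbf{1}_{(0,t]}(|X_p|)]=cp$.
   Context: An additive process on $\mathbb{R}^d$ is an $\mathbb{R}^d$-valued stochastic process $\{X_t\}_{t\ge 0}$ with $X_0=0$ a.s. that is stochastically continuous, has independent increments, and has sample paths that are right-continuous in $t\ge 0$ with left limits in $t>0$. A semi-Lévy process with period $p>0$ is an additive process such that $X_{t+p}-X_{s+p}$ and $X_t-X_s$ have the same distribution for all $s,t\ge 0$. $|x|$ denotes the Euclidean norm and $\mathbf{1}_B$ the indicator function of $B$. *)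

theory Defs
  imports "HOL-Probability.Probability"
begin

definition tendsto_in_prob ::
  "'w measure \<Rightarrow> ('i \<Rightarrow> 'w \<Rightarrow> 'a::euclidean_space) \<Rightarrow> ('w \<Rightarrow> 'a) \<Rightarrow> 'i filter \<Rightarrow> bool" where
  "tendsto_in_prob M Y Z F \<longleftrightarrow>
     (\<forall>\<epsilon>>0. ((\<lambda>i. measure M {\<omega> \<in> space M. norm (Y i \<omega> - Z \<omega>) > \<epsilon>}) \<longlongrightarrow> 0) F)"

text \<open>The time set is \<open>[0,\<infinity>)\<close>; values of \<open>X\<close> at negative times are unconstrained.\<close>

locale additive_process = prob_space M
  for M :: "'w measure" and X :: "real \<Rightarrow> 'w \<Rightarrow> 'a::euclidean_space" +
  assumes measurable_X: "\<And>t. t \<ge> 0 \<Longrightarrow> X t \<in> borel_measurable M"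
    and zero_at_0: "AE \<omega> in M. X 0 \<omega> = 0"
    and stochastically_continuous: "\<And>t. t \<ge> 0 \<Longrightarrow> tendsto_in_prob M X (X t) (at t within {0..})"
    and independent_increments: "\<And>(n::nat) (\<tau>::nat \<Rightarrow> real).
          0 \<le> \<tau> 0 \<Longrightarrow> (\<And>k. k < n \<Longrightarrow> \<tau> k < \<tau> (Suc k)) \<Longrightarrow>
          indep_vars (\<lambda>_. borel) (\<lambda>k \<omega>. X (\<tau> (Suc k)) \<omega> - X (\<tau> k) \<omega>) {..<n}"
    and right_continuous_paths: "\<And>\<omega> t. \<omega> \<in> space M \<Longrightarrow> t \<ge> 0 \<Longrightarrow>
          continuous (at_right t) (\<lambda>s. X s \<omega>)"
    and left_limits_paths: "\<And>\<omega> t. \<omega> \<in> space M \<Longrightarrow> t > 0 \<Longrightarrow>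
          \<exists>l. ((\<lambda>s. X s \<omega>) \<longlongrightarrow> l) (at_left t)"

locale semi_levy_process = additive_process M X
  for M :: "'w measure" and X :: "real \<Rightarrow> 'w \<Rightarrow> 'a::euclidean_space" and p :: real +
  assumes period_pos: "p > 0"
    and periodic_increments: "\<And>s t. s \<ge> 0 \<Longrightarrow> t \<ge> 0 \<Longrightarrow>
          distr M borel (\<lambda>\<omega>. X (t + p) \<omega> - X (s + p) \<omega>) = distr M borel (\<lambda>\<omega>. X t \<omega> - X s \<omega>)"

end

theory Submission
  imports Defs "HOL-Real_Asymp.Real_Asymp"
begin

text \<open>
  The values of a semi-Levy process at multiples of the period \<open>p\<close> are partial sums of independent
  vectors, all distributed like \<open>X p\<close>. Between two multiples of \<open>p\<close> the process moves by an
  increment whose law already occurs in the first period; by stochastic continuity these laws are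
  uniformly tight (\<open>uniform_tail_bound\<close>), so the increment is negligible against \<open>t\<close>. Hence
  \<open>X t / t\<close> converges to \<open>c\<close> in probability exactly when the averages of the period increments
  converge to \<open>p *\<^sub>R c\<close> (\<open>time_average_iff_period_average\<close>), and the claim is Feller's weak law
  of large numbers for independent identically distributed vectors
  (\<open>weak_law_of_large_numbers\<close>).

  Sufficiency in Feller's law is a truncation argument. Cutting the summands at height \<open>n\<close> changes
  the sum with probability at most \<open>n * P(|Y| > n)\<close>, while the second moment of the truncated
  summand is at most a sum of terms \<open>(2 * k + 1) * P(|Y| > k)\<close>, \<open>k < n\<close>, and under the tail condition this
  sum is of smaller order than \<open>n\<close>. So the sample mean differs from the truncated mean by a quantity
  tending to \<open>0\<close> in probability (\<open>sample_mean_minus_trunc_mean\<close>).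

  For necessity it is enough to derive the tail condition, because the convergence of the truncated
  means then follows from the same comparison. The Ottaviani inequality
  (\<open>ottaviani_inequality\<close>) shows that with high probability no partial sum, and so no single
  centred summand, is large on the scale \<open>n\<close>; by independence the probability of this is an \<open>n\<close>-th
  power \<open>(1 - q)\<^sup>n\<close>, whose convergence to \<open>1\<close> forces \<open>n * q\<close> to \<open>0\<close>
  (\<open>tail_of_sample_mean\<close>).
\<close>

section \<open>Cesaro means\<close>

lemma cesaro_mean_zero:
  fixes a :: "nat \<Rightarrow> real"
  assumes "a \<longlonglongrightarrow> 0"
  shows "(\<lambda>n. (\<Sum>k<n. a k) / n) \<longlonglongrightarrow> 0"
proof (rule tendstoI)
  fix e :: real assume e: "e > 0"
  obtain N where N: "\<And>k. k \<ge> N \<Longrightarrow> \<bar>a k\<bar> < e / 2"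
    using LIMSEQ_D[OF assms, of "e / 2"] e by auto
  define C where "C = (\<Sum>k<N. \<bar>a k\<bar>)"
  have "(\<lambda>n. C / real n) \<longlonglongrightarrow> 0" by real_asymp
  then have "\<forall>\<^sub>F n in sequentially. C / real n < e / 2"
    by (rule order_tendstoD) (use e in simp)
  then show "\<forall>\<^sub>F n in sequentially. dist ((\<Sum>k<n. a k) / n) 0 < e"
    using eventually_ge_at_top[of "max N 1"]
  proof eventually_elim
    case (elim n)
    have "\<bar>\<Sum>k<n. a k\<bar> \<le> (\<Sum>k<n. \<bar>a k\<bar>)" by (rule sum_abs)
    also have "\<dots> = C + (\<Sum>k\<in>{N..<n}. \<bar>a k\<bar>)"
      unfolding C_def using elim by (subst sum.union_disjoint[symmetric]) (auto intro!: sum.cong)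
    also have "(\<Sum>k\<in>{N..<n}. \<bar>a k\<bar>) \<le> (\<Sum>k\<in>{N..<n}. e / 2)"
      by (rule sum_mono) (use N in \<open>auto intro: less_imp_le\<close>)
    also have "\<dots> \<le> n * (e / 2)" using e by (simp add: mult_right_mono)
    finally have "\<bar>\<Sum>k<n. a k\<bar> \<le> C + n * (e / 2)" by simp
    then have "\<bar>\<Sum>k<n. a k\<bar> / n \<le> C / n + e / 2"
      using elim by (simp add: field_simps)
    also have "\<dots> < e" using elim by linarith
    finally show ?case by (simp add: dist_real_def)
  qed
qed

section \<open>Convergence in probability\<close>

context prob_space
begin

lemma tendsto_in_prob_of_tendsto:
  assumes "(v \<longlongrightarrow> 0) F"
  shows "tendsto_in_prob M (\<lambda>i _. v i) (\<lambda>_. 0) F"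
  unfolding tendsto_in_prob_def
proof (intro allI impI)
  fix e :: real assume "e > 0"
  with assms have "\<forall>\<^sub>F i in F. norm (v i) < e" by (simp add: tendsto_iff)
  then show "((\<lambda>i. prob {\<omega> \<in> space M. norm (v i - 0) > e}) \<longlongrightarrow> 0) F"
    by (intro tendsto_eventually) (auto elim!: eventually_mono)
qed

text \<open>For deterministic quantities each deviation event is empty or the whole space, so
  convergence in probability is ordinary convergence. This extracts the convergence of truncated
  means from statements about random averages.\<close>
lemma tendsto_of_tendsto_in_prob:
  assumes "tendsto_in_prob M (\<lambda>i _. v i) (\<lambda>_. 0) F"
  shows "(v \<longlongrightarrow> 0) F"
proof (rule tendstoI)
  fix e :: real assume e: "e > 0"
  have "((\<lambda>i. prob {\<omega> \<in> space M. norm (v i - 0) > e / 2}) \<longlongrightarrow> 0) F"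
    using assms e unfolding tendsto_in_prob_def by (meson half_gt_zero)
  then have "\<forall>\<^sub>F i in F. prob {\<omega> \<in> space M. norm (v i - 0) > e / 2} < 1"
    by (rule order_tendstoD) simp
  then show "\<forall>\<^sub>F i in F. dist (v i) 0 < e"
  proof eventually_elim
    case (elim i)
    have "\<not> norm (v i) > e / 2"
    proof
      assume "norm (v i) > e / 2"
      then have "{\<omega> \<in> space M. norm (v i - 0) > e / 2} = space M" by auto
      with elim show False by (simp add: prob_space)
    qed
    with e show ?case by simp
  qed
qed

text \<open>All passages between approximations below are instances of this one comparison: a deviation of
  more than \<open>\<epsilon>\<close> forces one of the two dominating terms above \<open>\<epsilon> / 2\<close>. The bound is only
  almost sure, because \<open>X 0 = 0\<close> is.\<close>
lemma tendsto_in_prob_add_bound: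
  fixes U V W :: "'i \<Rightarrow> 'a \<Rightarrow> 'b::euclidean_space"
  assumes U: "tendsto_in_prob M U (\<lambda>_. 0) F" and V: "tendsto_in_prob M V (\<lambda>_. 0) F"
    and meas: "\<forall>\<^sub>F i in F. random_variable borel (U i) \<and> random_variable borel (V i)"
    and bound: "\<forall>\<^sub>F i in F. AE \<omega> in M. norm (W i \<omega> - Z \<omega>) \<le> norm (U i \<omega>) + norm (V i \<omega>)"
  shows "tendsto_in_prob M W Z F"
  unfolding tendsto_in_prob_def
proof (intro allI impI)
  fix e :: real assume e: "e > 0"
  let ?u = "\<lambda>i. prob {\<omega> \<in> space M. norm (U i \<omega> - 0) > e / 2}"
  let ?v = "\<lambda>i. prob {\<omega> \<in> space M. norm (V i \<omega> - 0) > e / 2}"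
  have "((\<lambda>i. ?u i + ?v i) \<longlongrightarrow> 0 + 0) F"
    using U V half_gt_zero[OF e] unfolding tendsto_in_prob_def by (intro tendsto_add) blast+
  then have lim: "((\<lambda>i. ?u i + ?v i) \<longlongrightarrow> 0) F" by simp
  show "((\<lambda>i. prob {\<omega> \<in> space M. norm (W i \<omega> - Z \<omega>) > e}) \<longlongrightarrow> 0) F"
  proof (rule tendsto_sandwich[OF _ _ tendsto_const lim])
    show "\<forall>\<^sub>F i in F. prob {\<omega> \<in> space M. norm (W i \<omega> - Z \<omega>) > e} \<le> ?u i + ?v i"
      using meas bound
    proof eventually_elim
      case (elim i)
      then have [measurable]: "random_variable borel (U i)" "random_variable borel (V i)" by auto
      have "prob {\<omega> \<in> space M. norm (W i \<omega> - Z \<omega>) > e} \<le>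
        prob ({\<omega> \<in> space M. norm (U i \<omega> - 0) > e / 2} \<union> {\<omega> \<in> space M. norm (V i \<omega> - 0) > e / 2})"
        using elim(2) by (intro finite_measure_mono_AE) auto
      also have "\<dots> \<le> ?u i + ?v i" by (intro measure_subadditive) auto
      finally show ?case .
    qed
  qed auto
qed

lemma tail_prob_tendsto_0:
  assumes [measurable]: "random_variable borel (f :: 'a \<Rightarrow> real)"
  shows "((\<lambda>t. prob {\<omega> \<in> space M. f \<omega> > t}) \<longlongrightarrow> 0) at_top"
proof -
  have "((\<lambda>t. expectation (indicat_real {\<omega> \<in> space M. f \<omega> > t})) \<longlongrightarrow> expectation (\<lambda>_. 0)) (at_top :: real filter)"
  proof (rule integral_dominated_convergence_at_top[where w = "\<lambda>_. 1"])
    show "AE x in M. ((\<lambda>t. indicat_real {\<omega> \<in> space M. t < f \<omega>} x) \<longlongrightarrow> 0) at_top"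
      by (rule AE_I2, rule tendsto_eventually)
        (simp add: indicator_def not_less eventually_ge_at_top)
  qed (auto simp: indicator_def)
  then show ?thesis by simp
qed

section \<open>Independent vectors\<close>

lemma indep_vars_pair:
  assumes "indep_vars (\<lambda>_. N) Z I" "i \<in> I" "j \<in> I" "i \<noteq> j"
  shows "indep_var N (Z i) N (Z j)"
proof -
  have "indep_var N ((\<lambda>f. f i) \<circ> (\<lambda>\<omega>. \<lambda>k\<in>{i}. Z k \<omega>)) N ((\<lambda>f. f j) \<circ> (\<lambda>\<omega>. \<lambda>k\<in>{j}. Z k \<omega>))"
    using assms by (intro indep_var_compose[OF indep_var_restrict]) auto
  then show ?thesis by (simp add: comp_def)
qed

lemma
  fixes U V :: "'a \<Rightarrow> 'b::euclidean_space"
  assumes ind: "indep_var borel U borel V" and int: "integrable M U" "integrable M V"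
  shows expectation_inner_indep: "expectation (\<lambda>\<omega>. U \<omega> \<bullet> V \<omega>) = expectation U \<bullet> expectation V"
    and integrable_inner_indep: "integrable M (\<lambda>\<omega>. U \<omega> \<bullet> V \<omega>)"
proof -
  have ind_b: "indep_var borel (\<lambda>\<omega>. U \<omega> \<bullet> b) borel (\<lambda>\<omega>. V \<omega> \<bullet> b)" for b
    using indep_var_compose[OF ind, of "\<lambda>x. x \<bullet> b" borel "\<lambda>x. x \<bullet> b" borel] by (simp add: comp_def)
  have int_b: "integrable M (\<lambda>\<omega>. (U \<omega> \<bullet> b) * (V \<omega> \<bullet> b))" for b
    using int by (intro indep_var_integrable[OF ind_b]) auto
  then show "integrable M (\<lambda>\<omega>. U \<omega> \<bullet> V \<omega>)"
    by (subst euclidean_inner) auto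
  have "expectation (\<lambda>\<omega>. U \<omega> \<bullet> V \<omega>) = (\<Sum>b\<in>Basis. expectation (\<lambda>\<omega>. (U \<omega> \<bullet> b) * (V \<omega> \<bullet> b)))"
    using int_b by (subst euclidean_inner) (simp add: Bochner_Integration.integral_sum)
  also have "\<dots> = (\<Sum>b\<in>Basis. (expectation U \<bullet> b) * (expectation V \<bullet> b))"
    using int by (intro sum.cong refl, subst indep_var_lebesgue_integral[OF ind_b]) auto
  finally show "expectation (\<lambda>\<omega>. U \<omega> \<bullet> V \<omega>) = expectation U \<bullet> expectation V"
    by (subst euclidean_inner)
qed

text \<open>Centred independent vectors are pairwise orthogonal in \<open>L\<^sup>2\<close>, so this is Pythagoras. The
  Euclidean norm is kept throughout because the summands will be truncated by their norm.\<close>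
lemma second_moment_sum_indep:
  fixes Z :: "'i \<Rightarrow> 'a \<Rightarrow> 'b::euclidean_space"
  assumes ind: "indep_vars (\<lambda>_. borel) Z I" and "finite I"
    and int: "\<And>i. i \<in> I \<Longrightarrow> integrable M (Z i)" "\<And>i. i \<in> I \<Longrightarrow> integrable M (\<lambda>\<omega>. (norm (Z i \<omega>))\<^sup>2)"
    and mean: "\<And>i. i \<in> I \<Longrightarrow> expectation (Z i) = 0"
  shows "integrable M (\<lambda>\<omega>. (norm (\<Sum>i\<in>I. Z i \<omega>))\<^sup>2)"
    and "expectation (\<lambda>\<omega>. (norm (\<Sum>i\<in>I. Z i \<omega>))\<^sup>2) = (\<Sum>i\<in>I. expectation (\<lambda>\<omega>. (norm (Z i \<omega>))\<^sup>2))"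
proof -
  have expand: "(norm (\<Sum>i\<in>I. Z i \<omega>))\<^sup>2 = (\<Sum>i\<in>I. \<Sum>j\<in>I. Z i \<omega> \<bullet> Z j \<omega>)" for \<omega>
    by (simp add: power2_norm_eq_inner inner_sum_left inner_sum_right, rule sum.swap)
  have int2: "integrable M (\<lambda>\<omega>. Z i \<omega> \<bullet> Z j \<omega>)" if "i \<in> I" "j \<in> I" for i j
  proof (cases "i = j")
    case True
    with int(2)[OF that(1)] show ?thesis by (simp add: power2_norm_eq_inner)
  qed (use that int indep_vars_pair[OF ind] in \<open>auto intro!: integrable_inner_indep\<close>)
  have orth: "expectation (\<lambda>\<omega>. Z i \<omega> \<bullet> Z j \<omega>) = 0" if "i \<in> I" "j \<in> I" "i \<noteq> j" for i j
    using expectation_inner_indep[OF indep_vars_pair[OF ind that]] int that mean by simp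
  show "integrable M (\<lambda>\<omega>. (norm (\<Sum>i\<in>I. Z i \<omega>))\<^sup>2)"
    unfolding expand using int2 by auto
  have "expectation (\<lambda>\<omega>. (norm (\<Sum>i\<in>I. Z i \<omega>))\<^sup>2) = (\<Sum>i\<in>I. \<Sum>j\<in>I. expectation (\<lambda>\<omega>. Z i \<omega> \<bullet> Z j \<omega>))"
    unfolding expand using int2 by (simp add: Bochner_Integration.integral_sum)
  also have "\<dots> = (\<Sum>i\<in>I. \<Sum>j\<in>I. if j = i then expectation (\<lambda>\<omega>. Z i \<omega> \<bullet> Z i \<omega>) else 0)"
    using orth by (intro sum.cong refl) auto
  also have "\<dots> = (\<Sum>i\<in>I. expectation (\<lambda>\<omega>. (norm (Z i \<omega>))\<^sup>2))"
    using \<open>finite I\<close> by (simp add: power2_norm_eq_inner)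
  finally show "expectation (\<lambda>\<omega>. (norm (\<Sum>i\<in>I. Z i \<omega>))\<^sup>2) = (\<Sum>i\<in>I. expectation (\<lambda>\<omega>. (norm (Z i \<omega>))\<^sup>2))" .
qed

text \<open>Split according to the first \<open>k\<close> at which the partial sum exceeds \<open>a + b\<close>. That event depends
  only on the first \<open>k\<close> summands; independently of it, the remaining summands add up to at most
  \<open>a\<close> with probability at least \<open>\<beta>\<close>, and then the full sum still exceeds \<open>b\<close>. It
  takes the place of symmetrisation followed by the Levy inequality.\<close>
lemma ottaviani_inequality:
  fixes Z :: "nat \<Rightarrow> 'a \<Rightarrow> 'b::euclidean_space"
  assumes ind: "indep_vars (\<lambda>_. borel) Z {..<n}"
    and tail: "\<And>k. k \<le> n \<Longrightarrow> \<beta> \<le> prob {\<omega> \<in> space M. norm (\<Sum>i\<in>{k..<n}. Z i \<omega>) \<le> a}"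
  shows "\<beta> * prob {\<omega> \<in> space M. \<exists>k\<le>n. norm (\<Sum>i<k. Z i \<omega>) > a + b}
    \<le> prob {\<omega> \<in> space M. norm (\<Sum>i<n. Z i \<omega>) > b}"
proof -
  have [measurable]: "random_variable borel (Z i)" if "i < n" for i
    using ind that unfolding indep_vars_def by auto
  define T where "T k \<omega> = (\<Sum>i<k. Z i \<omega>)" for k \<omega>
  have T_meas [measurable]: "random_variable borel (T k)" if "k \<le> n" for k
    unfolding T_def using that by (intro borel_measurable_sum) auto
  \<comment> \<open>The events \<open>E k\<close> are disjoint, and on each \<open>E k \<inter> D k\<close> the full sum exceeds \<open>b\<close>.\<close>
  define E where "E k = {\<omega> \<in> space M. norm (T k \<omega>) > a + b \<and> (\<forall>j<k. norm (T j \<omega>) \<le> a + b)}" for k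
  define D where "D k = {\<omega> \<in> space M. norm (\<Sum>i\<in>{k..<n}. Z i \<omega>) \<le> a}" for k
  have E_ev: "E k \<in> events" if "k \<le> n" for k
    unfolding E_def using that by (measurable; auto)
  have D_ev: "D k \<in> events" for k
    unfolding D_def by measurable
  have indep: "prob (E k \<inter> D k) = prob (E k) * prob (D k)" if "k \<le> n" for k
  proof -
    \<comment> \<open>Both events are preimages under disjoint blocks of the family \<open>Z\<close>.\<close>
    let ?P = "\<lambda>J. PiM J (\<lambda>_. borel :: 'b measure)"
    let ?A = "{f \<in> space (?P {..<k}). norm (\<Sum>i<k. f i) > a + b \<and> (\<forall>j<k. norm (\<Sum>i<j. f i) \<le> a + b)}"
    let ?B = "{f \<in> space (?P {k..<n}). norm (\<Sum>i\<in>{k..<n}. f i) \<le> a}"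
    have m: "(\<lambda>f. \<Sum>i\<in>J. f i) \<in> borel_measurable (?P K)" if "J \<subseteq> K" for J K :: "nat set"
      using that by (intro borel_measurable_sum) (auto intro!: measurable_component_singleton)
    have "?A = {f \<in> space (?P {..<k}). norm (\<Sum>i<k. f i) > a + b \<and> (\<forall>j\<in>{..<k}. norm (\<Sum>i<j. f i) \<le> a + b)}"
      by auto
    also have "\<dots> \<in> sets (?P {..<k})"
      by (intro sets.sets_Collect_conj sets.sets_Collect_finite_All borel_measurable_less borel_measurable_le
          borel_measurable_norm m borel_measurable_const) auto
    finally have A: "?A \<in> sets (?P {..<k})" .
    have B: "?B \<in> sets (?P {k..<n})"
      by (intro borel_measurable_le borel_measurable_norm m borel_measurable_const) auto
    have iv: "indep_var (?P {..<k}) (\<lambda>\<omega>. \<lambda>i\<in>{..<k}. Z i \<omega>) (?P {k..<n}) (\<lambda>\<omega>. \<lambda>i\<in>{k..<n}. Z i \<omega>)"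
      using that by (intro indep_var_restrict[OF ind]) auto
    have "E k = (\<lambda>\<omega>. \<lambda>i\<in>{..<k}. Z i \<omega>) -` ?A \<inter> space M"
      unfolding E_def by (auto simp: space_PiM PiE_def extensional_def T_def)
    moreover have "D k = (\<lambda>\<omega>. \<lambda>i\<in>{k..<n}. Z i \<omega>) -` ?B \<inter> space M"
      unfolding D_def by (auto simp: space_PiM PiE_def extensional_def)
    moreover have "E k \<inter> D k = (\<lambda>\<omega>. (\<lambda>i\<in>{..<k}. Z i \<omega>, \<lambda>i\<in>{k..<n}. Z i \<omega>)) -` (?A \<times> ?B) \<inter> space M"
      unfolding calculation by auto
    ultimately show ?thesis
      using indep_varD[OF iv A B] by metis
  qed
  have disj: "disjoint_family_on E {..n}"
    unfolding disjoint_family_on_def E_def by (auto, metis linorder_neqE_nat not_less)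
  have union: "{\<omega> \<in> space M. \<exists>k\<le>n. norm (\<Sum>i<k. Z i \<omega>) > a + b} = (\<Union>k\<in>{..n}. E k)"
  proof (intro set_eqI iffI)
    fix \<omega> assume "\<omega> \<in> {\<omega> \<in> space M. \<exists>k\<le>n. norm (\<Sum>i<k. Z i \<omega>) > a + b}"
    then obtain k where k: "\<omega> \<in> space M" "k \<le> n" "norm (T k \<omega>) > a + b" unfolding T_def by auto
    define l where "l = (LEAST k. norm (T k \<omega>) > a + b)"
    have "norm (T l \<omega>) > a + b" "l \<le> k"
      unfolding l_def using k by (auto intro: LeastI Least_le)
    moreover have "\<forall>j<l. norm (T j \<omega>) \<le> a + b"
      unfolding l_def using not_less_Least by (meson not_le)
    ultimately have "\<omega> \<in> E l" "l \<le> n" using k by (auto simp: E_def)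
    then show "\<omega> \<in> (\<Union>k\<in>{..n}. E k)" by auto
  qed (auto simp: E_def T_def)
  have "\<beta> * prob (\<Union>k\<in>{..n}. E k) = (\<Sum>k\<le>n. prob (E k) * \<beta>)"
    using disj E_ev by (subst finite_measure_finite_Union) (auto simp: sum_distrib_left mult.commute)
  also have "\<dots> \<le> (\<Sum>k\<le>n. prob (E k) * prob (D k))"
    using tail by (intro sum_mono mult_left_mono) (auto simp: D_def)
  also have "\<dots> = prob (\<Union>k\<in>{..n}. E k \<inter> D k)"
    using E_ev D_ev indep disjoint_family_on_bisimulation[OF disj, of "\<lambda>k. E k \<inter> D k"]
    by (subst finite_measure_finite_Union) auto
  also have "\<dots> \<le> prob {\<omega> \<in> space M. norm (T n \<omega>) > b}"
  proof (rule finite_measure_mono)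
    show "(\<Union>k\<in>{..n}. E k \<inter> D k) \<subseteq> {\<omega> \<in> space M. norm (T n \<omega>) > b}"
    proof safe
      fix k \<omega> assume k: "k \<le> n" "\<omega> \<in> E k" "\<omega> \<in> D k"
      have split: "T n \<omega> = T k \<omega> + (\<Sum>i\<in>{k..<n}. Z i \<omega>)"
        unfolding T_def using k(1) by (simp add: lessThan_atLeast0 sum.atLeastLessThan_concat)
      show "norm (T n \<omega>) > b"
        using k norm_diff_ineq[of "T k \<omega>" "\<Sum>i\<in>{k..<n}. Z i \<omega>"] unfolding split E_def D_def by simp
      show "\<omega> \<in> space M" using k by (simp add: E_def)
    qed
  qed measurable
  finally show ?thesis unfolding union T_def .
qed

end

section \<open>The weak law for independent identically distributed vectors\<close>

text \<open>The half-open interval omits only the zero vector, whose truncation is \<open>0\<close> anyway; with it the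
  truncated mean is literally \<open>E[Y \<one>\<^bsub>(0,t]\<^esub>(|Y|)]\<close>.\<close>
definition truncate :: "real \<Rightarrow> 'b \<Rightarrow> 'b::euclidean_space" where
  "truncate r y = indicator {0<..r} (norm y) *\<^sub>R y"

lemma truncate_eq: "truncate r y = (if norm y \<le> r then y else 0)"
  by (auto simp: truncate_def indicator_def)

lemma measurable_truncate [measurable]: "truncate r \<in> borel_measurable borel"
  unfolding truncate_def by measurable

lemma norm_truncate_le: "r \<ge> 0 \<Longrightarrow> norm (truncate r y) \<le> r"
  by (simp add: truncate_eq)

text \<open>A discrete layer-cake bound: the odd numbers \<open>2 * k + 1\<close> with \<open>k < norm y\<close> add up to the square
  of \<open>\<lceil>norm y\<rceil>\<close>. Taking expectations turns tail probabilities into a second moment.\<close>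
lemma norm_truncate_sq_le_sum_tails:
  fixes y :: "'b::euclidean_space"
  shows "(norm (truncate (real n) y))\<^sup>2 \<le> (\<Sum>k<n. (2 * real k + 1) * indicator {r. r > real k} (norm y))"
proof (cases "norm y \<le> n")
  case True
  define m where "m = nat \<lceil>norm y\<rceil>"
  have m: "norm y \<le> m" "m \<le> n" and below: "k < m \<Longrightarrow> real k < norm y" for k
    using True unfolding m_def by (auto simp: zless_nat_eq_int_zless less_ceiling_iff nat_le_iff ceiling_le_iff)
  have "(norm (truncate (real n) y))\<^sup>2 \<le> (real m)\<^sup>2"
    using True m by (simp add: truncate_eq power_mono)
  also have "\<dots> = (\<Sum>k<m. 2 * real k + 1)"
    by (induction m) (auto simp: power2_eq_square algebra_simps)
  also have "\<dots> = (\<Sum>k<m. (2 * real k + 1) * indicator {r. r > real k} (norm y))"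
    using below by (intro sum.cong) auto
  also have "\<dots> \<le> (\<Sum>k<n. (2 * real k + 1) * indicator {r. r > real k} (norm y))"
    using m by (intro sum_mono2) auto
  finally show ?thesis .
qed (auto simp: truncate_eq intro!: sum_nonneg)

locale iid_sequence = prob_space M
  for M :: "'a measure" and Y :: "nat \<Rightarrow> 'a \<Rightarrow> 'b::euclidean_space" +
  assumes indep: "indep_vars (\<lambda>_. borel) Y UNIV"
    and ident: "distr M borel (Y k) = distr M borel (Y 0)"
begin

definition tail :: "real \<Rightarrow> real" where
  "tail t = prob {\<omega> \<in> space M. norm (Y 0 \<omega>) > t}"

definition trunc_mean :: "real \<Rightarrow> 'b" where
  "trunc_mean t = expectation (\<lambda>\<omega>. truncate t (Y 0 \<omega>))"

lemma measurable_Y [measurable]: "random_variable borel (Y k)"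
  using indep unfolding indep_vars_def by auto

lemma prob_Y_eq:
  assumes [measurable]: "Measurable.pred borel P"
  shows "prob {\<omega> \<in> space M. P (Y k \<omega>)} = prob {\<omega> \<in> space M. P (Y 0 \<omega>)}"
proof -
  have "prob {\<omega> \<in> space M. P (Y j \<omega>)} = measure (distr M borel (Y j)) {y. P y}" for j
    using assms by (subst measure_distr) (auto simp: pred_def intro!: arg_cong[where f = prob])
  then show ?thesis by (simp add: ident[of k])
qed

lemma expectation_Y_eq:
  fixes f :: "'b \<Rightarrow> 'c::{banach, second_countable_topology}"
  assumes [measurable]: "f \<in> borel_measurable borel"
  shows "expectation (\<lambda>\<omega>. f (Y k \<omega>)) = expectation (\<lambda>\<omega>. f (Y 0 \<omega>))"
proof -
  have "expectation (\<lambda>\<omega>. f (Y j \<omega>)) = integral\<^sup>L (distr M borel (Y j)) f" for j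
    by (simp add: integral_distr)
  then show ?thesis by (simp add: ident[of k])
qed

lemma integrable_truncate [simp]: "integrable M (\<lambda>\<omega>. truncate t (Y k \<omega>))"
proof -
  have "norm (truncate t y) \<le> \<bar>t\<bar>" for y :: 'b
    by (auto simp: truncate_eq)
  then show ?thesis by (intro integrable_const_bound[where B = "\<bar>t\<bar>"]) auto
qed

lemma tail_nonneg: "tail t \<ge> 0"
  by (simp add: tail_def)

lemma tail_antimono: "s \<le> t \<Longrightarrow> tail t \<le> tail s"
  unfolding tail_def by (intro finite_measure_mono) auto

lemma tail_tendsto_0: "(tail \<longlongrightarrow> 0) at_top"
  unfolding tail_def by (intro tail_prob_tendsto_0) measurable

lemma expectation_norm_truncate_sq_le:
  "expectation (\<lambda>\<omega>. (norm (truncate (real n) (Y 0 \<omega>)))\<^sup>2) \<le> (\<Sum>k<n. (2 * real k + 1) * tail (real k))"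
proof -
  let ?I = "\<lambda>k. {\<omega> \<in> space M. norm (Y 0 \<omega>) > real k}"
  have "expectation (\<lambda>\<omega>. (norm (truncate (real n) (Y 0 \<omega>)))\<^sup>2) \<le>
    expectation (\<lambda>\<omega>. \<Sum>k<n. (2 * real k + 1) * indicator (?I k) \<omega>)"
  proof (rule integral_mono)
    show "integrable M (\<lambda>\<omega>. (norm (truncate (real n) (Y 0 \<omega>)))\<^sup>2)"
      by (rule integrable_const_bound[where B = "(real n)\<^sup>2"])
        (auto intro!: AE_I2 power_mono norm_truncate_le)
    show "integrable M (\<lambda>\<omega>. \<Sum>k<n. (2 * real k + 1) * indicator (?I k) \<omega>)"
      by (intro Bochner_Integration.integrable_sum integrable_mult_right integrable_real_indicator)
        (auto simp: less_top[symmetric])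
    show "(norm (truncate (real n) (Y 0 \<omega>)))\<^sup>2 \<le> (\<Sum>k<n. (2 * real k + 1) * indicator (?I k) \<omega>)"
      if "\<omega> \<in> space M" for \<omega>
      using norm_truncate_sq_le_sum_tails[of n "Y 0 \<omega>"] that by (simp add: indicator_def)
  qed
  also have "\<dots> = (\<Sum>k<n. (2 * real k + 1) * tail (real k))"
    by (subst Bochner_Integration.integral_sum)
      (auto simp: tail_def less_top[symmetric] intro!: integrable_mult_right integrable_real_indicator)
  finally show ?thesis .
qed

text \<open>Truncate every summand at height \<open>n\<close>. The first term bounds the probability that truncation
  changes some summand; the second is the Markov inequality for the squared norm of the centred
  truncated sum, whose second moment is at most \<open>n * E|truncate n Y|\<^sup>2\<close>.\<close>
lemma prob_mean_deviation_le:
  assumes n: "n > 0" and e: "e > 0"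
  shows "prob {\<omega> \<in> space M. norm ((1 / real n) *\<^sub>R (\<Sum>k<n. Y k \<omega>) - trunc_mean (real n)) > e}
    \<le> n * tail (real n) + ((\<Sum>k<n. (2 * real k + 1) * tail (real k)) / n) / e\<^sup>2"
    (is "prob ?D \<le> _")
proof -
  define Z where "Z k \<omega> = truncate (real n) (Y k \<omega>) - trunc_mean (real n)" for k \<omega>
  have [measurable]: "random_variable borel (Z k)" for k unfolding Z_def by measurable
  have Z_bound: "norm (Z k \<omega>) \<le> n + norm (trunc_mean (real n))" for k \<omega>
    unfolding Z_def by (rule order_trans[OF norm_triangle_ineq4]) (simp add: norm_truncate_le)
  have Z_int: "integrable M (Z k)" for k
    using Z_bound by (intro integrable_const_bound) auto
  have Z_int2: "integrable M (\<lambda>\<omega>. (norm (Z k \<omega>))\<^sup>2)" for k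
    using Z_bound by (intro integrable_const_bound[where B = "(n + norm (trunc_mean (real n)))\<^sup>2"])
      (auto intro!: AE_I2 power_mono)
  have mean: "expectation (\<lambda>\<omega>. truncate (real n) (Y k \<omega>)) = trunc_mean (real n)" for k
    unfolding trunc_mean_def by (rule expectation_Y_eq) measurable
  have Z_mean: "expectation (Z k) = 0" for k
    unfolding Z_def by (simp add: mean prob_space)
  have Z_ind: "indep_vars (\<lambda>_. borel) Z {..<n}"
    unfolding Z_def by (rule indep_vars_compose2[OF indep_vars_subset[OF indep]]) auto
  let ?W = "\<lambda>\<omega>. (norm (\<Sum>k<n. Z k \<omega>))\<^sup>2"
  have W_int: "integrable M ?W"
    by (rule second_moment_sum_indep[OF Z_ind]) (auto simp: Z_int Z_int2 Z_mean)
  have Z_sq: "expectation (\<lambda>\<omega>. (norm (Z k \<omega>))\<^sup>2) \<le> (\<Sum>k<n. (2 * real k + 1) * tail (real k))" for k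
  proof -
    let ?t = "\<lambda>\<omega>. truncate (real n) (Y k \<omega>)"
    have t2: "integrable M (\<lambda>\<omega>. (norm (?t \<omega>))\<^sup>2)"
      by (rule integrable_const_bound[where B = "(real n)\<^sup>2"])
        (auto intro!: AE_I2 power_mono norm_truncate_le)
    have "expectation (\<lambda>\<omega>. (norm (Z k \<omega>))\<^sup>2) =
      expectation (\<lambda>\<omega>. (norm (?t \<omega>))\<^sup>2 + (norm (trunc_mean n))\<^sup>2 - 2 * (trunc_mean n \<bullet> ?t \<omega>))"
      unfolding Z_def power2_norm_eq_inner by (simp add: inner_diff_left inner_diff_right inner_commute)
    also have "\<dots> = expectation (\<lambda>\<omega>. (norm (?t \<omega>))\<^sup>2) - (norm (trunc_mean n))\<^sup>2"
      using t2 by (simp add: prob_space mean power2_norm_eq_inner)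
    also have "\<dots> \<le> expectation (\<lambda>\<omega>. (norm (?t \<omega>))\<^sup>2)" by simp
    also have "\<dots> = expectation (\<lambda>\<omega>. (norm (truncate (real n) (Y 0 \<omega>)))\<^sup>2)"
      by (rule expectation_Y_eq[where f = "\<lambda>y. (norm (truncate (real n) y))\<^sup>2"]) measurable
    finally show ?thesis using expectation_norm_truncate_sq_le[of n] by linarith
  qed
  let ?A = "\<lambda>k. {\<omega> \<in> space M. norm (Y k \<omega>) > n}"
  let ?B = "{\<omega> \<in> space M. ?W \<omega> \<ge> (n * e)\<^sup>2}"
  have "?D \<subseteq> (\<Union>k<n. ?A k) \<union> ?B"
  proof
    fix \<omega> assume \<omega>: "\<omega> \<in> ?D"
    show "\<omega> \<in> (\<Union>k<n. ?A k) \<union> ?B"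
    proof (cases "\<exists>k<n. norm (Y k \<omega>) > n")
      case False
      then have "(\<Sum>k<n. Z k \<omega>) = (\<Sum>k<n. Y k \<omega> - trunc_mean n)"
        by (intro sum.cong) (auto simp: Z_def truncate_eq)
      also have "\<dots> = n *\<^sub>R ((1 / real n) *\<^sub>R (\<Sum>k<n. Y k \<omega>) - trunc_mean n)"
        using n by (simp add: sum_subtractf scaleR_diff_right sum_constant_scaleR)
      finally have "norm (\<Sum>k<n. Z k \<omega>) \<ge> n * e"
        using \<omega> by (simp add: mult_left_mono)
      then have "?W \<omega> \<ge> (n * e)\<^sup>2" using e by (intro power_mono) auto
      with \<omega> show ?thesis by auto
    qed (use \<omega> in auto)
  qed
  then have "prob ?D \<le> prob ((\<Union>k<n. ?A k) \<union> ?B)"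
    by (intro finite_measure_mono) measurable
  also have "\<dots> \<le> prob (\<Union>k<n. ?A k) + prob ?B"
    by (intro measure_subadditive) measurable
  also have "prob (\<Union>k<n. ?A k) \<le> (\<Sum>k<n. prob (?A k))"
    by (intro finite_measure_subadditive_finite) auto
  also have "\<dots> = n * tail n"
  proof -
    have "prob (?A k) = tail n" for k
      unfolding tail_def by (rule prob_Y_eq[where P = "\<lambda>y. norm y > n"]) measurable
    then show ?thesis by simp
  qed
  also have "prob ?B \<le> expectation ?W / (n * e)\<^sup>2"
    using n e by (intro integral_Markov_inequality_measure[OF W_int, of "{}"]) auto
  also have "expectation ?W = (\<Sum>k<n. expectation (\<lambda>\<omega>. (norm (Z k \<omega>))\<^sup>2))"
    by (rule second_moment_sum_indep[OF Z_ind]) (auto simp: Z_int Z_int2 Z_mean)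
  also have "\<dots> / (n * e)\<^sup>2 \<le> (\<Sum>j<n. \<Sum>k<n. (2 * real k + 1) * tail (real k)) / (n * e)\<^sup>2"
    using Z_sq by (intro divide_right_mono sum_mono) auto
  also have "\<dots> = ((\<Sum>k<n. (2 * real k + 1) * tail (real k)) / n) / e\<^sup>2"
    using n by (simp add: power2_eq_square field_simps)
  finally show ?thesis by simp
qed

text \<open>By the previous estimate the deviation probability is governed by the Cesaro means of
  \<open>(2 * k + 1) * tail k\<close>, and these tend to \<open>0\<close> together with the sequence itself. Comparing with the
  truncated means rather than with their limit serves both directions of the weak law.\<close>
lemma sample_mean_minus_trunc_mean:
  assumes lim: "((\<lambda>t. t * tail t) \<longlongrightarrow> 0) at_top"
  shows "tendsto_in_prob M (\<lambda>n \<omega>. (1 / real n) *\<^sub>R (\<Sum>k<n. Y k \<omega>) - trunc_mean (real n)) (\<lambda>_. 0) sequentially"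
  unfolding tendsto_in_prob_def
proof (intro allI impI)
  fix e :: real assume e: "e > 0"
  have seq: "(\<lambda>n. real n * tail (real n)) \<longlonglongrightarrow> 0"
    by (rule filterlim_compose[OF lim filterlim_real_sequentially])
  have "(\<lambda>n. 2 * (real n * tail (real n)) + tail (real n)) \<longlonglongrightarrow> 2 * 0 + 0"
    by (intro tendsto_intros seq filterlim_compose[OF tail_tendsto_0 filterlim_real_sequentially])
  then have "(\<lambda>n. (2 * real n + 1) * tail (real n)) \<longlonglongrightarrow> 0"
    by (simp add: algebra_simps)
  from cesaro_mean_zero[OF this]
  have "(\<lambda>n. n * tail (real n) + ((\<Sum>k<n. (2 * real k + 1) * tail (real k)) / n) / e\<^sup>2) \<longlonglongrightarrow> 0 + 0 / e\<^sup>2"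
    using e by (intro tendsto_intros seq) auto
  then have lim': "(\<lambda>n. n * tail (real n) + ((\<Sum>k<n. (2 * real k + 1) * tail (real k)) / n) / e\<^sup>2) \<longlonglongrightarrow> 0"
    by simp
  show "(\<lambda>n. prob {\<omega> \<in> space M.
      norm ((1 / real n) *\<^sub>R (\<Sum>k<n. Y k \<omega>) - trunc_mean (real n) - 0) > e}) \<longlonglongrightarrow> 0"
  proof (rule tendsto_sandwich[OF _ _ tendsto_const lim'])
    show "\<forall>\<^sub>F n in sequentially. prob {\<omega> \<in> space M.
        norm ((1 / real n) *\<^sub>R (\<Sum>k<n. Y k \<omega>) - trunc_mean (real n) - 0) > e}
      \<le> n * tail (real n) + ((\<Sum>k<n. (2 * real k + 1) * tail (real k)) / n) / e\<^sup>2"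
      using eventually_gt_at_top[of 0]
    proof eventually_elim
      case (elim n)
      from prob_mean_deviation_le[OF this e] show ?case by simp
    qed
  qed auto
qed

lemma prob_all_le:
  fixes m :: 'b
  shows "prob {\<omega> \<in> space M. \<forall>k<n. norm (Y k \<omega> - m) \<le> r} =
    (1 - prob {\<omega> \<in> space M. norm (Y 0 \<omega> - m) > r}) ^ n"
proof (cases "n = 0")
  case False
  let ?C = "{y. norm (y - m) \<le> r}"
  have "{\<omega> \<in> space M. \<forall>k<n. norm (Y k \<omega> - m) \<le> r} = (\<Inter>k\<in>{..<n}. Y k -` ?C \<inter> space M)"
    using False by auto
  also have "prob \<dots> = (\<Prod>k<n. prob (Y k -` ?C \<inter> space M))"
    using False by (intro indep_varsD[OF indep]) auto
  also have "\<dots> = (\<Prod>k<n. 1 - prob {\<omega> \<in> space M. norm (Y 0 \<omega> - m) > r})"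
  proof (rule prod.cong)
    fix k
    have "Y k -` ?C \<inter> space M = space M - {\<omega> \<in> space M. norm (Y k \<omega> - m) > r}" by auto
    then have "prob (Y k -` ?C \<inter> space M) = 1 - prob {\<omega> \<in> space M. norm (Y k \<omega> - m) > r}"
      by (simp add: prob_compl)
    also have "prob {\<omega> \<in> space M. norm (Y k \<omega> - m) > r} = prob {\<omega> \<in> space M. norm (Y 0 \<omega> - m) > r}"
      by (rule prob_Y_eq[where P = "\<lambda>y. norm (y - m) > r"]) measurable
    finally show "prob (Y k -` ?C \<inter> space M) = 1 - prob {\<omega> \<in> space M. norm (Y 0 \<omega> - m) > r}" .
  qed simp
  finally show ?thesis by simp
qed (simp add: prob_space)

text \<open>Put \<open>Z = Y - m\<close>, with partial sums \<open>T\<close>. The Ottaviani inequality upgrades smallness of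
  \<open>T n\<close> to smallness of all \<open>T k\<close>, \<open>k \<le> n\<close>, on the scale \<open>n\<close>, hence of all increments \<open>Z k\<close>.
  So \<open>(1 - q)\<^sup>n \<longlonglongrightarrow> 1\<close> for \<open>q = P(|Z 0| > n / 2)\<close>, and as \<open>(1 - q)\<^sup>n \<le> exp (- n * q)\<close> this
  forces \<open>n * q \<longlonglongrightarrow> 0\<close>.\<close>
lemma tail_of_sample_mean:
  assumes lim: "tendsto_in_prob M (\<lambda>n \<omega>. (1 / real n) *\<^sub>R (\<Sum>k<n. Y k \<omega>)) (\<lambda>_. m) sequentially"
  shows "(\<lambda>n. real n * tail (real n)) \<longlonglongrightarrow> 0"
proof -
  define Z where "Z k \<omega> = Y k \<omega> - m" for k \<omega>
  define T where "T k \<omega> = (\<Sum>i<k. Z i \<omega>)" for k \<omega>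
  \<comment> \<open>An increment above \<open>n / 2\<close> forces a partial sum above \<open>n / 4 = 3 * h * n\<close>, and the
    Ottaviani inequality is applied with \<open>a = 2 * h * n\<close> and \<open>b = h * n\<close>.\<close>
  define h where "h = (1 / 12 :: real)"
  have h: "h > 0" by (simp add: h_def)
  have [measurable]: "random_variable borel (Z k)" for k unfolding Z_def by measurable
  have [measurable]: "random_variable borel (T k)" for k unfolding T_def by measurable
  have Z_ind: "indep_vars (\<lambda>_. borel) Z {..<n}" for n
    unfolding Z_def by (rule indep_vars_compose2[OF indep_vars_subset[OF indep]]) auto
  define d where "d k r = prob {\<omega> \<in> space M. norm (T k \<omega>) > r}" for k r
  have T_mean: "norm ((1 / real n) *\<^sub>R (\<Sum>k<n. Y k \<omega>) - m) = norm (T n \<omega>) / n" if "n > 0" for n \<omega>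
  proof -
    have "(1 / real n) *\<^sub>R (\<Sum>k<n. Y k \<omega>) - m = (1 / real n) *\<^sub>R T n \<omega>"
      using that by (simp add: T_def Z_def sum_subtractf sum_constant_scaleR scaleR_diff_right)
    then show ?thesis by simp
  qed
  have dn: "(\<lambda>n. d n (h * n)) \<longlonglongrightarrow> 0"
  proof -
    have "(\<lambda>n. prob {\<omega> \<in> space M. norm ((1 / real n) *\<^sub>R (\<Sum>k<n. Y k \<omega>) - m) > h}) \<longlonglongrightarrow> 0"
      using lim h unfolding tendsto_in_prob_def by auto
    moreover have "\<forall>\<^sub>F n in sequentially.
        prob {\<omega> \<in> space M. norm ((1 / real n) *\<^sub>R (\<Sum>k<n. Y k \<omega>) - m) > h} = d n (h * n)"
      using eventually_gt_at_top[of 0]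
      by eventually_elim (simp add: T_mean d_def field_simps)
    ultimately show ?thesis by (rule Lim_transform_eventually)
  qed
  \<comment> \<open>Large \<open>k\<close> are covered by convergence in probability, the finitely many small \<open>k\<close> by
    tightness of the single variables \<open>T k\<close>.\<close>
  have uniform: "\<forall>\<^sub>F n in sequentially. \<forall>k\<le>n. d k (h * n) \<le> 1 / 4"
  proof -
    from dn have "\<forall>\<^sub>F k in sequentially. d k (h * k) < 1 / 4"
      by (rule order_tendstoD) simp
    then obtain J where J: "\<And>k. k \<ge> J \<Longrightarrow> d k (h * k) < 1 / 4"
      by (auto simp: eventually_sequentially)
    have "((\<lambda>r. d k r) \<longlongrightarrow> 0) at_top" for k
      unfolding d_def by (intro tail_prob_tendsto_0) measurable
    moreover have "filterlim (\<lambda>n. h * real n) at_top sequentially"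
      unfolding h_def by real_asymp
    ultimately have "(\<lambda>n. d k (h * real n)) \<longlonglongrightarrow> 0" for k
      by (rule filterlim_compose)
    then have "\<forall>\<^sub>F n in sequentially. d k (h * real n) < 1 / 4" for k
      by (rule order_tendstoD) simp
    then have "\<forall>\<^sub>F n in sequentially. \<forall>k\<in>{..<J}. d k (h * real n) < 1 / 4"
      by (intro eventually_ball_finite) auto
    then show ?thesis
    proof eventually_elim
      case (elim n)
      show ?case
      proof (intro allI impI)
        fix k assume "k \<le> n"
        show "d k (h * n) \<le> 1 / 4"
        proof (cases "k < J")
          case False
          have "h * k \<le> h * n" using \<open>k \<le> n\<close> h by simp
          then have "d k (h * n) \<le> d k (h * k)"
            unfolding d_def by (intro finite_measure_mono) auto
          with J[of k] False show ?thesis by simp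
        qed (use elim in \<open>auto intro: less_imp_le\<close>)
      qed
    qed
  qed
  define q where "q n = prob {\<omega> \<in> space M. norm (Y 0 \<omega> - m) > n / 2}" for n :: nat
  have bound: "\<forall>\<^sub>F n in sequentially. 1 - 2 * d n (h * n) \<le> exp (- (n * q n))"
    using uniform
  proof eventually_elim
    case (elim n)
    \<comment> \<open>The block sum is \<open>T n - T k\<close>, so it is small when both ends are.\<close>
    have "1 / 2 \<le> prob {\<omega> \<in> space M. norm (\<Sum>i\<in>{k..<n}. Z i \<omega>) \<le> 2 * h * n}" if "k \<le> n" for k
    proof -
      let ?G = "{\<omega> \<in> space M. norm (\<Sum>i\<in>{k..<n}. Z i \<omega>) \<le> 2 * h * n}"
      have split: "T n \<omega> = T k \<omega> + (\<Sum>i\<in>{k..<n}. Z i \<omega>)" for \<omega>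
        unfolding T_def using that by (simp add: lessThan_atLeast0 sum.atLeastLessThan_concat)
      have "space M - ?G \<subseteq> {\<omega> \<in> space M. norm (T k \<omega>) > h * n} \<union> {\<omega> \<in> space M. norm (T n \<omega>) > h * n}"
      proof
        fix \<omega> assume \<omega>: "\<omega> \<in> space M - ?G"
        have "norm (\<Sum>i\<in>{k..<n}. Z i \<omega>) \<le> norm (T n \<omega>) + norm (T k \<omega>)"
          using norm_triangle_ineq4[of "T n \<omega>" "T k \<omega>"] by (simp add: split)
        with \<omega> show "\<omega> \<in> {\<omega> \<in> space M. norm (T k \<omega>) > h * n} \<union> {\<omega> \<in> space M. norm (T n \<omega>) > h * n}"
          by auto
      qed
      then have "prob (space M - ?G) \<le>
        prob ({\<omega> \<in> space M. norm (T k \<omega>) > h * n} \<union> {\<omega> \<in> space M. norm (T n \<omega>) > h * n})"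
        by (intro finite_measure_mono) auto
      also have "\<dots> \<le> d k (h * n) + d n (h * n)"
        unfolding d_def by (intro measure_subadditive) auto
      also have "\<dots> \<le> 1 / 4 + 1 / 4" using elim that by (intro add_mono) auto
      finally show ?thesis by (subst (asm) prob_compl) auto
    qed
    from ottaviani_inequality[OF Z_ind this, where b = "h * n"]
    have ott: "prob {\<omega> \<in> space M. \<exists>k\<le>n. norm (T k \<omega>) > 2 * h * n + h * n} \<le> 2 * d n (h * n)"
      unfolding T_def d_def by simp
    let ?S = "{\<omega> \<in> space M. \<forall>k<n. norm (Y k \<omega> - m) \<le> n / 2}"
    have "space M - ?S \<subseteq> {\<omega> \<in> space M. \<exists>k\<le>n. norm (T k \<omega>) > 2 * h * n + h * n}"
    proof
      fix \<omega> assume "\<omega> \<in> space M - ?S"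
      then obtain k where k: "\<omega> \<in> space M" "k < n" "norm (Z k \<omega>) > n / 2"
        by (auto simp: Z_def not_le)
      have "norm (Z k \<omega>) \<le> norm (T (Suc k) \<omega>) + norm (T k \<omega>)"
        using norm_triangle_ineq4[of "T (Suc k) \<omega>" "T k \<omega>"] by (simp add: T_def)
      with k(3) have "norm (T (Suc k) \<omega>) > n / 4 \<or> norm (T k \<omega>) > n / 4" by linarith
      then have "\<exists>j\<le>n. norm (T j \<omega>) > n / 4" using k(2) by (meson Suc_leI less_imp_le)
      then show "\<omega> \<in> {\<omega> \<in> space M. \<exists>k\<le>n. norm (T k \<omega>) > 2 * h * n + h * n}"
        using k(1) by (simp add: h_def)
    qed
    then have "prob (space M - ?S) \<le> prob {\<omega> \<in> space M. \<exists>k\<le>n. norm (T k \<omega>) > 2 * h * n + h * n}"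
      by (intro finite_measure_mono) auto
    with ott have "1 - prob ?S \<le> 2 * d n (h * n)" by (subst (asm) prob_compl) auto
    moreover have "prob ?S = (1 - q n) ^ n" unfolding q_def by (rule prob_all_le)
    moreover have "(1 - q n) ^ n \<le> exp (- q n) ^ n"
    proof (rule power_mono)
      show "1 - q n \<le> exp (- q n)" using exp_ge_add_one_self[of "- q n"] by simp
    qed (simp add: q_def)
    ultimately show ?case by (simp add: exp_of_nat_mult[symmetric])
  qed
  have nq: "(\<lambda>n. n * q n) \<longlonglongrightarrow> 0"
  proof -
    have "(\<lambda>n. 1 - 2 * d n (h * n)) \<longlonglongrightarrow> 1 - 2 * 0" by (intro tendsto_intros dn)
    then have one: "(\<lambda>n. 1 - 2 * d n (h * n)) \<longlonglongrightarrow> 1" by simp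
    then have "(\<lambda>n. - ln (1 - 2 * d n (h * n))) \<longlonglongrightarrow> - ln 1" by (intro tendsto_intros) auto
    then have upper: "(\<lambda>n. - ln (1 - 2 * d n (h * n))) \<longlonglongrightarrow> 0" by simp
    have "\<forall>\<^sub>F n in sequentially. 1 - 2 * d n (h * n) > 0"
      using one by (rule order_tendstoD) simp
    with bound have le: "\<forall>\<^sub>F n in sequentially. n * q n \<le> - ln (1 - 2 * d n (h * n))"
    proof eventually_elim
      case (elim n)
      then have "ln (1 - 2 * d n (h * n)) \<le> ln (exp (- (n * q n)))" by (subst ln_le_cancel_iff) auto
      then show ?case by simp
    qed
    show ?thesis
      by (rule tendsto_sandwich[OF _ le tendsto_const upper]) (simp add: q_def)
  qed
  \<comment> \<open>Shifting by \<open>m\<close> is absorbed once \<open>n \<ge> 2 * norm m\<close>.\<close>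
  have le: "\<forall>\<^sub>F n in sequentially. n * tail n \<le> n * q n"
    using eventually_ge_at_top[of "nat \<lceil>2 * norm m\<rceil>"]
  proof eventually_elim
    case (elim n)
    then have "2 * norm m \<le> n" by linarith
    then have "norm (y - m) > n / 2" if "norm y > n" for y
      using that norm_triangle_ineq2[of y m] by linarith
    then show ?case unfolding tail_def q_def by (intro mult_left_mono finite_measure_mono) auto
  qed
  show ?thesis
    by (rule tendsto_sandwich[OF _ le tendsto_const nq]) (simp add: tail_nonneg)
qed

lemma norm_trunc_mean_diff_le:
  assumes "0 \<le> s" "s \<le> t"
  shows "norm (trunc_mean t - trunc_mean s) \<le> t * tail s"
proof -
  have "trunc_mean t - trunc_mean s = expectation (\<lambda>\<omega>. truncate t (Y 0 \<omega>) - truncate s (Y 0 \<omega>))"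
    unfolding trunc_mean_def by simp
  also have "norm \<dots> \<le> expectation (\<lambda>\<omega>. t * indicator {\<omega> \<in> space M. norm (Y 0 \<omega>) > s} \<omega>)"
    using assms by (intro order_trans[OF integral_norm_bound integral_mono] integrable_mult_right
        integrable_real_indicator Bochner_Integration.integrable_diff integrable_truncate integrable_norm)
      (auto simp: truncate_eq indicator_def less_top[symmetric])
  also have "\<dots> = t * tail s" by (simp add: tail_def)
  finally show ?thesis .
qed

text \<open>Feller's weak law. Under the tail condition the sample mean and the truncated mean at \<open>n\<close> merge in
  probability, so one converges exactly when the other does; conversely convergence of the sample
  mean enforces the tail condition. The tail bound also controls the variation of tail and
  truncated mean between consecutive integers, which carries the limits over to real \<open>t\<close>.\<close>
theorem weak_law_of_large_numbers:
  "tendsto_in_prob M (\<lambda>n \<omega>. (1 / real n) *\<^sub>R (\<Sum>k<n. Y k \<omega>)) (\<lambda>_. m) sequentially \<longleftrightarrow>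
    ((\<lambda>t. t * tail t) \<longlongrightarrow> 0) at_top \<and> (trunc_mean \<longlongrightarrow> m) at_top"
    (is "?L \<longleftrightarrow> ?T \<and> ?E")
proof
  assume L: ?L
  have floor: "filterlim (\<lambda>t::real. nat \<lfloor>t\<rfloor>) sequentially at_top"
    by (rule filterlim_compose[OF filterlim_nat_sequentially filterlim_floor_sequentially])
  have "(\<lambda>n. real n * tail (real n) + tail (real n)) \<longlonglongrightarrow> 0 + 0"
    by (intro tendsto_add tail_of_sample_mean[OF L] filterlim_compose[OF tail_tendsto_0 filterlim_real_sequentially])
  then have lim_nat: "(\<lambda>n. (real n + 1) * tail (real n)) \<longlonglongrightarrow> 0"
    by (simp add: algebra_simps)
  have lim: "((\<lambda>t::real. (real (nat \<lfloor>t\<rfloor>) + 1) * tail (real (nat \<lfloor>t\<rfloor>))) \<longlongrightarrow> 0) at_top"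
    by (rule filterlim_compose[OF lim_nat floor])
  have T: ?T
  proof (rule tendsto_sandwich[OF _ _ tendsto_const lim])
    show "\<forall>\<^sub>F t in at_top. t * tail t \<le> (real (nat \<lfloor>t\<rfloor>) + 1) * tail (real (nat \<lfloor>t\<rfloor>))"
      using eventually_ge_at_top[of 0]
      by eventually_elim (intro mult_mono tail_antimono; simp add: tail_nonneg)
    show "\<forall>\<^sub>F t in at_top. 0 \<le> t * tail t"
      using eventually_ge_at_top[of 0] by eventually_elim (simp add: tail_nonneg)
  qed
  have "tendsto_in_prob M (\<lambda>n \<omega>. m - trunc_mean (real n)) (\<lambda>_. 0) sequentially"
  proof (rule tendsto_in_prob_add_bound[OF sample_mean_minus_trunc_mean[OF T]])
    show "tendsto_in_prob M (\<lambda>n \<omega>. (1 / real n) *\<^sub>R (\<Sum>k<n. Y k \<omega>) - m) (\<lambda>_. 0) sequentially"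
      using L unfolding tendsto_in_prob_def by simp
    show "\<forall>\<^sub>F n in sequentially. AE \<omega> in M. norm (m - trunc_mean (real n) - 0) \<le>
      norm ((1 / real n) *\<^sub>R (\<Sum>k<n. Y k \<omega>) - trunc_mean (real n)) +
      norm ((1 / real n) *\<^sub>R (\<Sum>k<n. Y k \<omega>) - m)"
    proof (intro always_eventually allI AE_I2)
      fix n \<omega>
      show "norm (m - trunc_mean (real n) - 0) \<le>
        norm ((1 / real n) *\<^sub>R (\<Sum>k<n. Y k \<omega>) - trunc_mean (real n)) +
        norm ((1 / real n) *\<^sub>R (\<Sum>k<n. Y k \<omega>) - m)"
        using norm_triangle_ineq4[of "(1 / real n) *\<^sub>R (\<Sum>k<n. Y k \<omega>) - trunc_mean (real n)"
          "(1 / real n) *\<^sub>R (\<Sum>k<n. Y k \<omega>) - m"] by simp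
    qed
  qed auto
  then have seq: "(\<lambda>n. m - trunc_mean (real n)) \<longlonglongrightarrow> 0"
    by (rule tendsto_of_tendsto_in_prob)
  have diff: "((\<lambda>t::real. trunc_mean t - trunc_mean (real (nat \<lfloor>t\<rfloor>))) \<longlongrightarrow> 0) at_top"
  proof (rule Lim_null_comparison[OF _ lim])
    show "\<forall>\<^sub>F t in at_top. norm (trunc_mean t - trunc_mean (real (nat \<lfloor>t\<rfloor>))) \<le>
        (real (nat \<lfloor>t\<rfloor>) + 1) * tail (real (nat \<lfloor>t\<rfloor>))"
      using eventually_ge_at_top[of 0]
    proof eventually_elim
      case (elim t)
      then have "norm (trunc_mean t - trunc_mean (real (nat \<lfloor>t\<rfloor>))) \<le> t * tail (real (nat \<lfloor>t\<rfloor>))"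
        by (intro norm_trunc_mean_diff_le) auto
      also have "\<dots> \<le> (real (nat \<lfloor>t\<rfloor>) + 1) * tail (real (nat \<lfloor>t\<rfloor>))"
        using elim by (intro mult_right_mono tail_nonneg) simp
      finally show ?case .
    qed
  qed
  have "((\<lambda>t::real. m - trunc_mean (real (nat \<lfloor>t\<rfloor>))) \<longlongrightarrow> 0) at_top"
    by (rule filterlim_compose[OF seq floor])
  from tendsto_diff[OF diff this] have "((\<lambda>t. trunc_mean t - m) \<longlongrightarrow> 0) at_top" by simp
  then have ?E by (simp add: LIM_zero_iff)
  with T show "?T \<and> ?E" ..
next
  assume R: "?T \<and> ?E"
  then have "(\<lambda>n. trunc_mean (real n)) \<longlonglongrightarrow> m"
    using filterlim_compose[OF _ filterlim_real_sequentially] by blast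
  then have "(\<lambda>n. trunc_mean (real n) - m) \<longlonglongrightarrow> 0" by (simp add: LIM_zero_iff)
  from tendsto_in_prob_of_tendsto[OF this] show ?L
  proof (rule tendsto_in_prob_add_bound[rotated])
    show "tendsto_in_prob M (\<lambda>n \<omega>. (1 / real n) *\<^sub>R (\<Sum>k<n. Y k \<omega>) - trunc_mean (real n)) (\<lambda>_. 0) sequentially"
      using R by (intro sample_mean_minus_trunc_mean) simp
    show "\<forall>\<^sub>F n in sequentially. AE \<omega> in M. norm ((1 / real n) *\<^sub>R (\<Sum>k<n. Y k \<omega>) - m) \<le>
      norm ((1 / real n) *\<^sub>R (\<Sum>k<n. Y k \<omega>) - trunc_mean (real n)) + norm (trunc_mean (real n) - m)"
      by (intro always_eventually allI AE_I2 norm_diff_triangle_le[OF order_refl order_refl])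
  qed auto
qed

end

section \<open>Additive processes: independence and tightness\<close>

text \<open>Independence of a family is a condition on its finite subfamilies, and every finite set of
  naturals lies in an initial segment. This is the form in which independent increments are given.\<close>
lemma (in prob_space) indep_vars_UNIV_of_initial_segments:
  assumes "\<And>n::nat. indep_vars N Z {..<n}"
  shows "indep_vars N Z UNIV"
  unfolding indep_vars_def
proof
  show "\<forall>i\<in>UNIV. random_variable (N i) (Z i)"
    using assms[of "Suc _"] unfolding indep_vars_def by auto
  let ?F = "\<lambda>i. sigma_sets (space M) {Z i -` A \<inter> space M | A. A \<in> sets (N i)}"
  show "indep_sets ?F UNIV"
  proof (subst indep_sets_finite_index_sets, intro allI impI)
    fix J :: "nat set" assume "finite J"
    then obtain n where "J \<subseteq> {..<n}" by (meson finite_nat_iff_bounded)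
    moreover have "indep_sets ?F {..<n}" using assms[of n] unfolding indep_vars_def by simp
    ultimately show "indep_sets ?F J" by (rule indep_sets_mono_index)
  qed
qed

context additive_process
begin

text \<open>Stochastic continuity spreads a tail bound at \<open>t\<close> to a neighbourhood of \<open>t\<close>, and finitely
  many neighbourhoods cover the compact interval; so the laws of the process on it are uniformly
  tight.\<close>
lemma uniform_tail_bound:
  assumes e: "e > 0"
  shows "\<exists>K. \<forall>s\<in>{0..b}. prob {\<omega> \<in> space M. norm (X s \<omega>) > K} \<le> e"
proof -
  have local: "\<exists>d K. d > 0 \<and> (\<forall>s\<in>{0..b}. dist s t < d \<longrightarrow> prob {\<omega> \<in> space M. norm (X s \<omega>) > K} \<le> e)"
    if t: "t \<in> {0..b}" for t
  proof -
    have Xt [measurable]: "random_variable borel (X t)" using t by (intro measurable_X) auto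
    have "\<forall>\<^sub>F K in at_top. prob {\<omega> \<in> space M. norm (X t \<omega>) > K} < e / 2"
      using e by (intro order_tendstoD(2)[OF tail_prob_tendsto_0]) auto
    then obtain K where K: "prob {\<omega> \<in> space M. norm (X t \<omega>) > K} < e / 2"
      by (auto dest: eventually_happens'[rotated])
    have "((\<lambda>s. prob {\<omega> \<in> space M. norm (X s \<omega> - X t \<omega>) > 1}) \<longlongrightarrow> 0) (at t within {0..})"
      using stochastically_continuous[of t] t unfolding tendsto_in_prob_def by auto
    then have "\<forall>\<^sub>F s in at t within {0..}. prob {\<omega> \<in> space M. norm (X s \<omega> - X t \<omega>) > 1} < e / 2"
      by (rule order_tendstoD) (use e in simp)
    then obtain d where d: "d > 0"
      "\<And>s. s \<ge> 0 \<Longrightarrow> s \<noteq> t \<Longrightarrow> dist s t < d \<Longrightarrow> prob {\<omega> \<in> space M. norm (X s \<omega> - X t \<omega>) > 1} < e / 2"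
      unfolding eventually_at by auto
    have "prob {\<omega> \<in> space M. norm (X s \<omega>) > K + 1} \<le> e" if s: "s \<in> {0..b}" "dist s t < d" for s
    proof -
      have [measurable]: "random_variable borel (X s)" using s by (intro measurable_X) auto
      let ?D = "{\<omega> \<in> space M. norm (X s \<omega> - X t \<omega>) > 1}"
      let ?T = "{\<omega> \<in> space M. norm (X t \<omega>) > K}"
      have D: "prob ?D < e / 2"
        using d(2)[of s] s e by (cases "s = t") auto
      have "{\<omega> \<in> space M. norm (X s \<omega>) > K + 1} \<subseteq> ?D \<union> ?T"
      proof
        fix \<omega> assume "\<omega> \<in> {\<omega> \<in> space M. norm (X s \<omega>) > K + 1}"
        then show "\<omega> \<in> ?D \<union> ?T" using norm_triangle_sub[of "X s \<omega>" "X t \<omega>"] by auto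
      qed
      then have "prob {\<omega> \<in> space M. norm (X s \<omega>) > K + 1} \<le> prob (?D \<union> ?T)"
        by (intro finite_measure_mono) auto
      also have "\<dots> \<le> prob ?D + prob ?T" by (intro measure_subadditive) auto
      finally show ?thesis using D K by linarith
    qed
    with d(1) show ?thesis by blast
  qed
  then have "\<forall>t\<in>{0..b}. \<exists>d. \<exists>K. d > 0 \<and>
      (\<forall>s\<in>{0..b}. dist s t < d \<longrightarrow> prob {\<omega> \<in> space M. norm (X s \<omega>) > K} \<le> e)"
    by blast
  from bchoice[OF this] obtain d where "\<forall>t\<in>{0..b}. \<exists>K. d t > 0 \<and>
      (\<forall>s\<in>{0..b}. dist s t < d t \<longrightarrow> prob {\<omega> \<in> space M. norm (X s \<omega>) > K} \<le> e)" ..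
  from bchoice[OF this] obtain K where dK: "\<forall>t\<in>{0..b}. d t > 0 \<and>
      (\<forall>s\<in>{0..b}. dist s t < d t \<longrightarrow> prob {\<omega> \<in> space M. norm (X s \<omega>) > K t} \<le> e)" ..
  have "compact {0..b}" by simp
  then obtain C where C: "C \<subseteq> {0..b}" "finite C" "{0..b} \<subseteq> (\<Union>t\<in>C. ball t (d t))"
  proof (rule compactE_image[where C = "{0..b}" and f = "\<lambda>t. ball t (d t)"])
    show "{0..b} \<subseteq> (\<Union>t\<in>{0..b}. ball t (d t))"
      using dK by (intro subsetI UN_I[of _ "{0..b}"]) auto
  qed auto
  have "prob {\<omega> \<in> space M. norm (X s \<omega>) > Max (K ` C)} \<le> e" if s: "s \<in> {0..b}" for s
  proof -
    from C(3) s obtain t where "t \<in> C" "s \<in> ball t (d t)" by blast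
    then have t: "t \<in> C" "dist s t < d t" by (simp_all add: dist_commute)
    have [measurable]: "random_variable borel (X s)" using s by (intro measurable_X) auto
    have "K t \<le> Max (K ` C)" using C t by auto
    then have "prob {\<omega> \<in> space M. norm (X s \<omega>) > Max (K ` C)} \<le> prob {\<omega> \<in> space M. norm (X s \<omega>) > K t}"
      by (intro finite_measure_mono) auto
    also have "\<dots> \<le> e" using dK t s C(1) by blast
    finally show ?thesis .
  qed
  then show ?thesis by blast
qed

end

section \<open>Reduction of a semi-Levy process to its period increments\<close>

context semi_levy_process
begin

lemma periodic_increments_multiple:
  assumes "s \<ge> 0" "t \<ge> 0"
  shows "distr M borel (\<lambda>\<omega>. X (t + real k * p) \<omega> - X (s + real k * p) \<omega>) =
    distr M borel (\<lambda>\<omega>. X t \<omega> - X s \<omega>)"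
proof (induction k)
  case (Suc k)
  have "distr M borel (\<lambda>\<omega>. X ((t + real k * p) + p) \<omega> - X ((s + real k * p) + p) \<omega>) =
    distr M borel (\<lambda>\<omega>. X (t + real k * p) \<omega> - X (s + real k * p) \<omega>)"
    using assms period_pos by (intro periodic_increments) auto
  with Suc show ?case by (simp add: algebra_simps)
qed simp

definition period_increment :: "nat \<Rightarrow> 'w \<Rightarrow> 'a" where
  "period_increment k \<omega> = X (real (Suc k) * p) \<omega> - X (real k * p) \<omega>"

lemma sum_period_increment: "(\<Sum>k<n. period_increment k \<omega>) = X (real n * p) \<omega> - X 0 \<omega>"
  unfolding period_increment_def using sum_lessThan_telescope[of "\<lambda>k. X (real k * p) \<omega>" n] by simp

sublocale period: iid_sequence M period_increment
proof
  have "indep_vars (\<lambda>_. borel) period_increment {..<n}" for n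
    unfolding period_increment_def
    by (rule independent_increments[of "\<lambda>k. real k * p"]) (use period_pos in auto)
  then show "indep_vars (\<lambda>_. borel) period_increment UNIV"
    by (rule indep_vars_UNIV_of_initial_segments)
  show "distr M borel (period_increment k) = distr M borel (period_increment 0)" for k
    using periodic_increments_multiple[of 0 p k] period_pos
    by (simp add: period_increment_def[abs_def] algebra_simps)
qed

lemma AE_period_increment_0: "AE \<omega> in M. period_increment 0 \<omega> = X p \<omega>"
  using zero_at_0 by eventually_elim (simp add: period_increment_def)

lemma measurable_X_period [measurable]:
  "random_variable borel (X 0)" "random_variable borel (X (real k * p))" "random_variable borel (X p)"
  using period_pos by (auto intro!: measurable_X)

lemma tail_eq: "period.tail t = prob {\<omega> \<in> space M. norm (X p \<omega>) > t}"
  unfolding period.tail_def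
proof (rule finite_measure_eq_AE)
  show "AE \<omega> in M. \<omega> \<in> {\<omega> \<in> space M. norm (period_increment 0 \<omega>) > t} \<longleftrightarrow>
      \<omega> \<in> {\<omega> \<in> space M. norm (X p \<omega>) > t}"
    using AE_period_increment_0 by eventually_elim simp
qed measurable

lemma trunc_mean_eq: "period.trunc_mean t = expectation (\<lambda>\<omega>. indicator {0<..t} (norm (X p \<omega>)) *\<^sub>R X p \<omega>)"
  unfolding period.trunc_mean_def truncate_def[symmetric]
proof (rule integral_cong_AE)
  show "AE \<omega> in M. truncate t (period_increment 0 \<omega>) = truncate t (X p \<omega>)"
    using AE_period_increment_0 by eventually_elim simp
qed measurable

text \<open>Periodicity moves the increment since the last multiple of \<open>p\<close> back into the first period, where
  its tails are bounded uniformly; dividing by \<open>t\<close> therefore annihilates it.\<close>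
lemma increment_within_period_negligible:
  "tendsto_in_prob M (\<lambda>t \<omega>. (1 / t) *\<^sub>R (X t \<omega> - X (real (nat \<lfloor>t / p\<rfloor>) * p) \<omega>)) (\<lambda>_. 0) at_top"
  unfolding tendsto_in_prob_def
proof (intro allI impI)
  fix e :: real assume e: "e > 0"
  let ?n = "\<lambda>t. nat \<lfloor>t / p\<rfloor>"
  let ?P = "\<lambda>t. prob {\<omega> \<in> space M. norm ((1 / t) *\<^sub>R (X t \<omega> - X (real (?n t) * p) \<omega>) - 0) > e}"
  show "(?P \<longlongrightarrow> 0) at_top"
  proof (rule order_tendstoI)
    fix a :: real assume "a > 0"
    obtain K where K: "\<And>s. s \<in> {0..p} \<Longrightarrow> prob {\<omega> \<in> space M. norm (X s \<omega>) > K} \<le> a / 2"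
      using uniform_tail_bound[of "a / 2" p] \<open>a > 0\<close> by (meson half_gt_zero)
    show "\<forall>\<^sub>F t in at_top. ?P t < a"
      using eventually_ge_at_top[of "K / e"] eventually_gt_at_top[of 0]
    proof eventually_elim
      case (elim t)
      define s where "s = t - real (?n t) * p"
      have n: "real (?n t) \<le> t / p" "t / p < real (?n t) + 1"
        using elim period_pos by simp_all
      then have s: "s \<in> {0..p}"
        using period_pos unfolding s_def by (auto simp: field_simps)
      have [measurable]: "random_variable borel (X t)" "random_variable borel (X s)" "random_variable borel (X 0)"
        using elim s by (auto intro!: measurable_X)
      have "e * t \<ge> K" using elim e by (simp add: field_simps)
      then have "?P t \<le> prob {\<omega> \<in> space M. norm (X t \<omega> - X (real (?n t) * p) \<omega>) > K}"
      proof (intro finite_measure_mono subsetI)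
        fix \<omega> assume "\<omega> \<in> {\<omega> \<in> space M. norm ((1 / t) *\<^sub>R (X t \<omega> - X (real (?n t) * p) \<omega>) - 0) > e}"
        then have "\<omega> \<in> space M" "norm (X t \<omega> - X (real (?n t) * p) \<omega>) > e * t"
          using elim by (auto simp: pos_less_divide_eq)
        with \<open>e * t \<ge> K\<close> show "\<omega> \<in> {\<omega> \<in> space M. norm (X t \<omega> - X (real (?n t) * p) \<omega>) > K}"
          by simp
      qed measurable
      also have "\<dots> = measure (distr M borel (\<lambda>\<omega>. X t \<omega> - X (real (?n t) * p) \<omega>)) {x. norm x > K}"
        by (subst measure_distr) (auto intro!: arg_cong[where f = prob])
      also have "distr M borel (\<lambda>\<omega>. X t \<omega> - X (real (?n t) * p) \<omega>) = distr M borel (\<lambda>\<omega>. X s \<omega> - X 0 \<omega>)"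
        using periodic_increments_multiple[of 0 s "?n t"] s by (simp add: s_def)
      also have "measure \<dots> {x. norm x > K} = prob {\<omega> \<in> space M. norm (X s \<omega> - X 0 \<omega>) > K}"
        by (subst measure_distr) (auto intro!: arg_cong[where f = prob])
      also have "\<dots> = prob {\<omega> \<in> space M. norm (X s \<omega>) > K}"
      proof (rule finite_measure_eq_AE)
        show "AE \<omega> in M. \<omega> \<in> {\<omega> \<in> space M. norm (X s \<omega> - X 0 \<omega>) > K} \<longleftrightarrow>
            \<omega> \<in> {\<omega> \<in> space M. norm (X s \<omega>) > K}"
          using zero_at_0 by eventually_elim simp
      qed measurable
      also have "\<dots> \<le> a / 2" by (rule K[OF s])
      finally show ?case using \<open>a > 0\<close> by simp
    qed
  qed (rule always_eventually, rule allI, erule less_le_trans, rule measure_nonneg)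
qed

text \<open>Forward, restrict to the times \<open>n * p\<close>. Backward, with \<open>n = \<lfloor>t / p\<rfloor>\<close>, the deviation of
  \<open>X t / t\<close> from \<open>c\<close> consists of that of the period average, the increment within the current
  period, and a drift error caused by \<open>n * p / t \<noteq> 1\<close>.\<close>
lemma time_average_iff_period_average:
  "tendsto_in_prob M (\<lambda>t \<omega>. (1 / t) *\<^sub>R X t \<omega>) (\<lambda>_. c) at_top \<longleftrightarrow>
    tendsto_in_prob M (\<lambda>n \<omega>. (1 / real n) *\<^sub>R (\<Sum>k<n. period_increment k \<omega>)) (\<lambda>_. p *\<^sub>R c) sequentially"
    (is "?L \<longleftrightarrow> ?R")
proof
  assume L: ?L
  show ?R
    unfolding tendsto_in_prob_def
  proof (intro allI impI)
    fix e :: real assume e: "e > 0"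
    have "((\<lambda>t. prob {\<omega> \<in> space M. norm ((1 / t) *\<^sub>R X t \<omega> - c) > e / p}) \<longlongrightarrow> 0) at_top"
      using L e period_pos unfolding tendsto_in_prob_def by simp
    moreover have "filterlim (\<lambda>n. real n * p) at_top sequentially"
      using period_pos by real_asymp
    ultimately have lim: "(\<lambda>n. prob {\<omega> \<in> space M. norm ((1 / (real n * p)) *\<^sub>R X (real n * p) \<omega> - c) > e / p})
        \<longlonglongrightarrow> 0"
      by (rule filterlim_compose)
    show "(\<lambda>n. prob {\<omega> \<in> space M. norm ((1 / real n) *\<^sub>R (\<Sum>k<n. period_increment k \<omega>) - p *\<^sub>R c) > e})
        \<longlonglongrightarrow> 0"
    proof (rule Lim_transform_eventually[OF lim], rule always_eventually, rule allI)
      fix n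
      have "norm ((1 / (real n * p)) *\<^sub>R x - c) > e / p \<longleftrightarrow> norm ((1 / real n) *\<^sub>R x - p *\<^sub>R c) > e" for x
      proof -
        have "(1 / real n) *\<^sub>R x - p *\<^sub>R c = p *\<^sub>R ((1 / (real n * p)) *\<^sub>R x - c)"
          using period_pos by (simp add: scaleR_diff_right)
        then have "norm ((1 / real n) *\<^sub>R x - p *\<^sub>R c) = p * norm ((1 / (real n * p)) *\<^sub>R x - c)"
          using period_pos by simp
        then show ?thesis using period_pos by (simp add: pos_divide_less_eq mult.commute)
      qed
      then show "prob {\<omega> \<in> space M. norm ((1 / (real n * p)) *\<^sub>R X (real n * p) \<omega> - c) > e / p} =
        prob {\<omega> \<in> space M. norm ((1 / real n) *\<^sub>R (\<Sum>k<n. period_increment k \<omega>) - p *\<^sub>R c) > e}"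
        unfolding sum_period_increment
      proof (intro finite_measure_eq_AE)
        assume iff: "\<And>x. norm ((1 / (real n * p)) *\<^sub>R x - c) > e / p \<longleftrightarrow> norm ((1 / real n) *\<^sub>R x - p *\<^sub>R c) > e"
        show "AE \<omega> in M. \<omega> \<in> {\<omega> \<in> space M. norm ((1 / (real n * p)) *\<^sub>R X (real n * p) \<omega> - c) > e / p} \<longleftrightarrow>
            \<omega> \<in> {\<omega> \<in> space M. norm ((1 / real n) *\<^sub>R (X (real n * p) \<omega> - X 0 \<omega>) - p *\<^sub>R c) > e}"
          using zero_at_0 unfolding iff by eventually_elim simp
      qed measurable
    qed
  qed
next
  assume R: ?R
  let ?n = "\<lambda>t. nat \<lfloor>t / p\<rfloor>"
  define U where "U t \<omega> = (1 / p) *\<^sub>R ((1 / real (?n t)) *\<^sub>R (\<Sum>k<?n t. period_increment k \<omega>) - p *\<^sub>R c)" for t \<omega>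
  define V where "V t \<omega> = (1 / t) *\<^sub>R (X t \<omega> - X (real (?n t) * p) \<omega>)" for t \<omega>
  define r where "r t = real (?n t) * p / t" for t
  have n_lim: "filterlim ?n sequentially at_top"
  proof -
    have "filterlim (\<lambda>t. t / p) at_top at_top" using period_pos by real_asymp
    from filterlim_compose[OF filterlim_compose[OF filterlim_nat_sequentially filterlim_floor_sequentially] this]
    show ?thesis by simp
  qed
  have U: "tendsto_in_prob M U (\<lambda>_. 0) at_top"
    unfolding tendsto_in_prob_def
  proof (intro allI impI)
    fix e :: real assume "e > 0"
    then have lim: "(\<lambda>n. prob {\<omega> \<in> space M.
        norm ((1 / real n) *\<^sub>R (\<Sum>k<n. period_increment k \<omega>) - p *\<^sub>R c) > e * p}) \<longlonglongrightarrow> 0"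
      using R period_pos unfolding tendsto_in_prob_def by simp
    have U_iff: "norm (U t \<omega> - 0) > e \<longleftrightarrow>
        norm ((1 / real (?n t)) *\<^sub>R (\<Sum>k<?n t. period_increment k \<omega>) - p *\<^sub>R c) > e * p" for t \<omega>
      using period_pos by (simp add: U_def pos_less_divide_eq)
    show "((\<lambda>t. prob {\<omega> \<in> space M. norm (U t \<omega> - 0) > e}) \<longlongrightarrow> 0) at_top"
      unfolding U_iff by (rule filterlim_compose[OF lim n_lim])
  qed
  have V: "tendsto_in_prob M V (\<lambda>_. 0) at_top"
    unfolding V_def by (rule increment_within_period_negligible)
  have n_bounds: "real (?n t) \<le> t / p" "t / p < real (?n t) + 1" if "t > 0" for t
    using that period_pos by simp_all
  have r_bounds: "1 - p / t \<le> r t" "r t \<le> 1" if "t > 0" for t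
  proof -
    define m where "m = real (?n t)"
    have "m \<le> t / p" "t / p < m + 1" unfolding m_def using n_bounds[OF that] by blast+
    then have "t - p \<le> m * p" "m * p \<le> t" using period_pos by (auto simp: field_simps)
    then have "(t - p) / t \<le> m * p / t" "m * p / t \<le> t / t"
      using that by (intro divide_right_mono; simp)+
    moreover have "(t - p) / t = 1 - p / t" "t / t = 1" using that by (simp_all add: diff_divide_distrib)
    ultimately show "1 - p / t \<le> r t" "r t \<le> 1" unfolding r_def m_def by simp_all
  qed
  have r: "(r \<longlongrightarrow> 1) at_top"
  proof (rule tendsto_sandwich[OF _ _ _ tendsto_const])
    show "((\<lambda>t. 1 - p / t) \<longlongrightarrow> 1) at_top" by real_asymp
    show "\<forall>\<^sub>F t in at_top. 1 - p / t \<le> r t" "\<forall>\<^sub>F t in at_top. r t \<le> 1"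
      by (rule eventually_mono[OF eventually_gt_at_top[of 0]], erule r_bounds)+
  qed
  have "((\<lambda>t. (r t - 1) *\<^sub>R c) \<longlongrightarrow> (1 - 1) *\<^sub>R c) at_top"
    by (rule tendsto_scaleR[OF tendsto_diff[OF r tendsto_const] tendsto_const])
  then have "((\<lambda>t. (r t - 1) *\<^sub>R c) \<longlongrightarrow> 0) at_top"
    unfolding diff_self scaleR_zero_left .
  note drift = tendsto_in_prob_of_tendsto[OF this]
  have U_meas: "random_variable borel (U t)" for t
    unfolding U_def by measurable
  have V_meas: "random_variable borel (V t)" if "t > 0" for t
  proof -
    have [measurable]: "random_variable borel (X t)" using that by (intro measurable_X) simp
    show ?thesis unfolding V_def by measurable
  qed
  have VD: "tendsto_in_prob M (\<lambda>t \<omega>. V t \<omega> + (r t - 1) *\<^sub>R c) (\<lambda>_. 0) at_top"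
  proof (rule tendsto_in_prob_add_bound[OF V drift])
    show "\<forall>\<^sub>F t in at_top. random_variable borel (V t) \<and> random_variable borel (\<lambda>_. (r t - 1) *\<^sub>R c)"
      using eventually_gt_at_top[of 0]
      by eventually_elim (simp add: V_meas)
    show "\<forall>\<^sub>F t in at_top. AE \<omega> in M. norm (V t \<omega> + (r t - 1) *\<^sub>R c - 0) \<le>
      norm (V t \<omega>) + norm ((r t - 1) *\<^sub>R c)"
      unfolding diff_0_right by (intro always_eventually allI AE_I2 norm_triangle_ineq)
  qed
  show ?L
  proof (rule tendsto_in_prob_add_bound[OF U VD])
    show "\<forall>\<^sub>F t in at_top. random_variable borel (U t) \<and> random_variable borel (\<lambda>\<omega>. V t \<omega> + (r t - 1) *\<^sub>R c)"
      using eventually_gt_at_top[of 0]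
      by eventually_elim (simp add: U_meas V_meas borel_measurable_add)
    show "\<forall>\<^sub>F t in at_top. AE \<omega> in M. norm ((1 / t) *\<^sub>R X t \<omega> - c) \<le>
      norm (U t \<omega>) + norm (V t \<omega> + (r t - 1) *\<^sub>R c)"
      using eventually_ge_at_top[of p]
    proof eventually_elim
      case (elim t)
      then have t: "t > 0" "?n t > 0" using period_pos by (auto simp: pos_le_divide_eq)
      have r01: "0 \<le> r t" "r t \<le> 1" using r_bounds(2)[OF t(1)] t period_pos by (auto simp: r_def)
      show ?case
        using zero_at_0
      proof eventually_elim
        case (elim \<omega>)
        have rU: "r t *\<^sub>R U t \<omega> = (1 / t) *\<^sub>R X (real (?n t) * p) \<omega> - r t *\<^sub>R c"
          unfolding U_def sum_period_increment using elim t period_pos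
          by (simp add: r_def scaleR_diff_right del: zero_less_nat_eq)
        have "(1 / t) *\<^sub>R X t \<omega> - c = r t *\<^sub>R U t \<omega> + (V t \<omega> + (r t - 1) *\<^sub>R c)"
          unfolding rU V_def scaleR_diff_right scaleR_diff_left scaleR_one by (simp only: algebra_simps)
        also have "norm \<dots> \<le> norm (r t *\<^sub>R U t \<omega>) + norm (V t \<omega> + (r t - 1) *\<^sub>R c)"
          by (rule norm_triangle_ineq)
        also have "norm (r t *\<^sub>R U t \<omega>) \<le> norm (U t \<omega>)"
          unfolding norm_scaleR abs_of_nonneg[OF r01(1)] by (rule mult_left_le_one_le[OF norm_ge_zero r01])
        finally show ?case by simp
      qed
    qed
  qed
qed

end

section \<open>The weak law for semi-Levy processes\<close>

theorem theorem5p3: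
  fixes M :: "'w measure" and X :: "real \<Rightarrow> 'w \<Rightarrow> real ^ 'd" and p :: real and c :: "real ^ 'd"
  assumes "semi_levy_process M X p"
  shows "tendsto_in_prob M (\<lambda>t \<omega>. (1 / t) *\<^sub>R X t \<omega>) (\<lambda>_. c) at_top \<longleftrightarrow>
    ((\<lambda>t::real. t * measure M {\<omega> \<in> space M. norm (X p \<omega>) > t}) \<longlongrightarrow> 0) at_top \<and>
    ((\<lambda>t::real. \<integral>\<omega>. indicator {0<..t} (norm (X p \<omega>)) *\<^sub>R X p \<omega> \<partial>M) \<longlongrightarrow> p *\<^sub>R c) at_top"
proof -
  interpret semi_levy_process M X p by fact
  show ?thesis
    unfolding time_average_iff_period_average period.weak_law_of_large_numbers
    unfolding tail_eq trunc_mean_eq[abs_def] ..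
qed

end
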